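(* Let $\gamma : I \to \mathbb{E}^3$ be a unit speed curve of osculating order $3$ with Bishop frame $\{T, M_1, M_2\}$ and Bishop curvatures $k_1, k_2$. If $\gamma$ is of type Bishop $AW(2)$, then for all $s \in I$ $$k_2'(s)\left(k_1''(s) - k_1^3(s) - k_1(s) k_2^2(s)\right) = k_1'(s)\left(k_2''(s) - k_2^3(s) - k_1^2(s) k_2(s)\right).$$
   Context: $I \subset \mathbb{R}$ is an interval, $\mathbb{E}^3$ is Euclidean 3-space with inner product $\langle\cdot,\cdot\rangle$ and norm $\|\cdot\|$, curves are smooth, and primes denote derivatives with respect to the arc length parameter $s$. A unit speed curve satisfies $\|\gamma'(s)\| = 1$. It is of (osculating) order $3$ if $\gamma'(s), \gamma''(s), \gamma'''(s)$ are linearly independent for all $s$. A Bishop frame (parallel transport frame) along $\gamma$ is an orthonormal frame $\{T, M_1, M_2\}$ with $T = \gamma'$ satisfying $$T' = k_1 M_1 + k_2 M_2, \qquad M_1' = -k_1 T, \qquad M_2' = -k_2 T,$$ where the functions $k_1, k_2$ are called the first and second Bishop curvatures. Write $$\overline{N}_2 = k_1' M_1 + k_2' M_2, \qquad \overline{N}_3 = \left(k_1'' - k_1^3 - k_1 k_2^2\right) M_1 + \left(k_2'' - k_2^3 - k_1^2 k_2\right) M_2.$$ The curve is of type Bishop $AW(2)$ if $\|\overline{N}_2\|^2\, \overline{N}_3 = \langle \overline{N}_3, \overline{N}_2\rangle\, \overline{N}_2$ at every $s \in I$. *)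

theory Defs
  imports "HOL-Analysis.Analysis"
begin

(* All derivatives are taken within the parameter interval I, so they are one-sided at
   endpoints belonging to I; they are uniquely determined because I is nondegenerate. *)

definition nondegenerate_interval :: "real set \<Rightarrow> bool" where
  "nondegenerate_interval I \<longleftrightarrow> is_interval I \<and> (\<exists>a\<in>I. \<exists>b\<in>I. a < b)"

definition D :: "real set \<Rightarrow> (real \<Rightarrow> 'a::real_normed_vector) \<Rightarrow> real \<Rightarrow> 'a" where
  "D I f s = vector_derivative f (at s within I)"

definition smooth_within :: "real set \<Rightarrow> (real \<Rightarrow> 'a::real_normed_vector) \<Rightarrow> bool" where
  "smooth_within I f \<longleftrightarrow> (\<forall>n. \<forall>s\<in>I. (D I ^^ n) f differentiable (at s within I))"

definition unit_speed_curve :: "real set \<Rightarrow> (real \<Rightarrow> real^3) \<Rightarrow> bool" where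
  "unit_speed_curve I \<gamma> \<longleftrightarrow> smooth_within I \<gamma> \<and> (\<forall>s\<in>I. norm (D I \<gamma> s) = 1)"

(* Distinctness is needed because independence is a property of the set, in which
   repeated vectors would be identified. *)
definition osculating_order_3 :: "real set \<Rightarrow> (real \<Rightarrow> real^3) \<Rightarrow> bool" where
  "osculating_order_3 I \<gamma> \<longleftrightarrow>
     (\<forall>s\<in>I. let vs = map (\<lambda>n. (D I ^^ n) \<gamma> s) [1, 2, 3]
            in distinct vs \<and> independent (set vs))"

(* The smoothness clauses only spell out the convention that all data are smooth:
   for smooth \<gamma> they already follow from the remaining clauses, since
   k_i = \<langle>T', M_i\<rangle> and M_i' = - k_i T. *)
definition bishop_frame ::
  "real set \<Rightarrow> (real \<Rightarrow> real^3) \<Rightarrow> (real \<Rightarrow> real^3) \<Rightarrow> (real \<Rightarrow> real^3) \<Rightarrow> (real \<Rightarrow> real^3)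
    \<Rightarrow> (real \<Rightarrow> real) \<Rightarrow> (real \<Rightarrow> real) \<Rightarrow> bool" where
  "bishop_frame I \<gamma> T M1 M2 k1 k2 \<longleftrightarrow>
     smooth_within I M1 \<and> smooth_within I M2 \<and> smooth_within I k1 \<and> smooth_within I k2 \<and>
     (\<forall>s\<in>I.
        T s = D I \<gamma> s \<and>
        norm (T s) = 1 \<and> norm (M1 s) = 1 \<and> norm (M2 s) = 1 \<and>
        T s \<bullet> M1 s = 0 \<and> T s \<bullet> M2 s = 0 \<and> M1 s \<bullet> M2 s = 0 \<and>
        (T has_vector_derivative k1 s *\<^sub>R M1 s + k2 s *\<^sub>R M2 s) (at s within I) \<and>
        (M1 has_vector_derivative - k1 s *\<^sub>R T s) (at s within I) \<and>
        (M2 has_vector_derivative - k2 s *\<^sub>R T s) (at s within I))"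

definition N2_bar ::
  "real set \<Rightarrow> (real \<Rightarrow> real^3) \<Rightarrow> (real \<Rightarrow> real^3) \<Rightarrow> (real \<Rightarrow> real) \<Rightarrow> (real \<Rightarrow> real)
    \<Rightarrow> real \<Rightarrow> real^3" where
  "N2_bar I M1 M2 k1 k2 s = D I k1 s *\<^sub>R M1 s + D I k2 s *\<^sub>R M2 s"

definition N3_bar ::
  "real set \<Rightarrow> (real \<Rightarrow> real^3) \<Rightarrow> (real \<Rightarrow> real^3) \<Rightarrow> (real \<Rightarrow> real) \<Rightarrow> (real \<Rightarrow> real)
    \<Rightarrow> real \<Rightarrow> real^3" where
  "N3_bar I M1 M2 k1 k2 s =
     (D I (D I k1) s - k1 s ^ 3 - k1 s * k2 s ^ 2) *\<^sub>R M1 s +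
     (D I (D I k2) s - k2 s ^ 3 - k1 s ^ 2 * k2 s) *\<^sub>R M2 s"

definition bishop_AW2 ::
  "real set \<Rightarrow> (real \<Rightarrow> real^3) \<Rightarrow> (real \<Rightarrow> real^3) \<Rightarrow> (real \<Rightarrow> real) \<Rightarrow> (real \<Rightarrow> real)
    \<Rightarrow> bool" where
  "bishop_AW2 I M1 M2 k1 k2 \<longleftrightarrow>
     (\<forall>s\<in>I. (norm (N2_bar I M1 M2 k1 k2 s)) ^ 2 *\<^sub>R N3_bar I M1 M2 k1 k2 s =
            (N3_bar I M1 M2 k1 k2 s \<bullet> N2_bar I M1 M2 k1 k2 s) *\<^sub>R N2_bar I M1 M2 k1 k2 s)"

end

theory Submission
  imports Defs
begin

text \<open>
  The claim is pointwise and needs only linear algebra. The \<open>AW(2)\<close> condition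
  \<open>\<parallel>N\<^sub>2\<parallel>\<^sup>2 N\<^sub>3 = \<langle>N\<^sub>3, N\<^sub>2\<rangle> N\<^sub>2\<close> is the equality case of the Cauchy--Schwarz inequality, so at each
  parameter value the vectors \<open>N\<^sub>2\<close> and \<open>N\<^sub>3\<close> are linearly dependent. Both lie in the plane spanned
  by the orthonormal pair \<open>M\<^sub>1, M\<^sub>2\<close>, where linear dependence means that the determinant of the
  coordinates vanishes. That determinant is the difference of the two sides of the claimed identity.
\<close>

text \<open>
  The \<open>u\<close>- and \<open>v\<close>-coordinates of the hypothesis say that the determinant \<open>q * a - p * b\<close> is killed
  by both \<open>q\<close> and \<open>p\<close>; hence it is killed by itself and vanishes.
\<close>

lemma orthonormal_pair_projection_imp_det_zero:
  fixes u v :: "'a::real_inner"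
  assumes u: "norm u = 1" and v: "norm v = 1" and uv: "u \<bullet> v = 0"
    and x: "x = p *\<^sub>R u + q *\<^sub>R v" and y: "y = a *\<^sub>R u + b *\<^sub>R v"
    and proj: "(norm x)\<^sup>2 *\<^sub>R y = (y \<bullet> x) *\<^sub>R x"
  shows "q * a = p * b"
proof -
  have ip: "u \<bullet> u = 1" "v \<bullet> v = 1" "v \<bullet> u = 0"
    using u v uv by (simp_all add: norm_eq_1 inner_commute)
  have xx: "(norm x)\<^sup>2 = p * p + q * q"
    unfolding power2_norm_eq_inner x using ip uv by (simp add: algebra_simps)
  have yx: "y \<bullet> x = a * p + b * q"
    unfolding x y using ip uv by (simp add: algebra_simps)
  have "((norm x)\<^sup>2 *\<^sub>R y) \<bullet> u = ((y \<bullet> x) *\<^sub>R x) \<bullet> u"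
    using proj by simp
  then have "(p * p + q * q) * a = (a * p + b * q) * p"
    unfolding xx yx using ip uv by (simp add: x y algebra_simps)
  then have "q * (q * a - p * b) = 0"
    by (auto simp: algebra_simps)
  moreover
  have "((norm x)\<^sup>2 *\<^sub>R y) \<bullet> v = ((y \<bullet> x) *\<^sub>R x) \<bullet> v"
    using proj by simp
  then have "(p * p + q * q) * b = (a * p + b * q) * q"
    unfolding xx yx using ip uv by (simp add: x y algebra_simps)
  then have "p * (q * a - p * b) = 0"
    by (auto simp: algebra_simps)
  ultimately show ?thesis
    by auto
qed

theorem proposition4p9:
  fixes I :: "real set" and \<gamma> T M1 M2 :: "real \<Rightarrow> real^3" and k1 k2 :: "real \<Rightarrow> real"
  assumes "nondegenerate_interval I"
    and "unit_speed_curve I \<gamma>"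
    and "osculating_order_3 I \<gamma>"
    and "bishop_frame I \<gamma> T M1 M2 k1 k2"
    and "bishop_AW2 I M1 M2 k1 k2"
  shows "\<forall>s\<in>I. D I k2 s * (D I (D I k1) s - k1 s ^ 3 - k1 s * k2 s ^ 2) =
               D I k1 s * (D I (D I k2) s - k2 s ^ 3 - k1 s ^ 2 * k2 s)"
proof
  fix s assume s: "s \<in> I"
  have "norm (M1 s) = 1" "norm (M2 s) = 1" "M1 s \<bullet> M2 s = 0"
    using assms(4) s unfolding bishop_frame_def by blast+
  moreover have "(norm (N2_bar I M1 M2 k1 k2 s))\<^sup>2 *\<^sub>R N3_bar I M1 M2 k1 k2 s =
      (N3_bar I M1 M2 k1 k2 s \<bullet> N2_bar I M1 M2 k1 k2 s) *\<^sub>R N2_bar I M1 M2 k1 k2 s"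
    using assms(5) s unfolding bishop_AW2_def by blast
  ultimately show "D I k2 s * (D I (D I k1) s - k1 s ^ 3 - k1 s * k2 s ^ 2) =
      D I k1 s * (D I (D I k2) s - k2 s ^ 3 - k1 s ^ 2 * k2 s)"
    by (rule orthonormal_pair_projection_imp_det_zero[OF _ _ _ N2_bar_def N3_bar_def])
qed

end
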